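(* Let $r$ be a positive rational number and $\eta>0$ a real number. For every real number $x$ that is sufficiently large in terms of $r$ and $\eta$, there is a set $S$ of positive integers not exceeding $x$ such that $r=\sum_{n\in S}1/n$ and $|S|>(C(r)-\eta)x$, where \[ C(r)=(1-\log 2)\Big(1-\exp\Big(\frac{-r}{1-\log 2}\Big)\Big). \]
   Context: Sums $\sum_{n\in S}1/n$ over a set $S$ are sums of reciprocals of distinct positive integers (Egyptian fractions). *)

theory Defs
  imports Complex_Main
begin

definition egyptian_density :: "real \<Rightarrow> real" where
  "egyptian_density r = (1 - ln 2) * (1 - exp (- r / (1 - ln 2)))"

end

theory Submission
  imports Defs "HOL-Number_Theory.Prime_Powers" "HOL-Number_Theory.Cong" "HOL-Library.Nat_Bijection"
    "HOL-Real_Asymp.Real_Asymp"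
begin

text \<open>
  Fix a small \<open>\<delta> > 0\<close> and put \<open>P = x powr (1/2 - \<delta>)\<close>. By Mertens' theorem, the integers in an
  interval of length proportional to \<open>x\<close> that have no prime factor above \<open>P\<close> and no large square
  divisor have density close to \<open>c = 1 - ln 2\<close>. Selecting them with constant density in
  \<open>(x * exp (-r/c), x]\<close> gives a set \<open>S\<^sub>0\<close> of the required size whose reciprocal sum is slightly
  below \<open>r\<close>.

  Choose \<open>2 ^ T\<close> of order \<open>sqrt x\<close>. Each prime \<open>p \<le> P\<close> that is not small occurs only to the first
  power in the denominator of the remainder, and it is cancelled by subtracting \<open>t / (p * 2 ^ T)\<close> for a
  suitable \<open>t < p\<close>; the binary expansion of \<open>t\<close> writes this as a sum of distinct fractions
  \<open>1 / (p * 2 ^ i)\<close>. All these corrections together are at most \<open>P / 2 ^ T\<close>, and their denominators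
  \<open>p * 2 ^ i\<close> are \<open>o(x)\<close>, hence below \<open>S\<^sub>0\<close>. What is left is a number in \<open>[0, 1)\<close> of the form
  \<open>N / (D * 2 ^ T)\<close> with \<open>D\<close> bounded; writing \<open>N = D * a + b\<close> and expanding \<open>a\<close> and \<open>b\<close> in
  binary finishes the representation.
\<close>

section \<open>Chebyshev and Mertens estimates for primes\<close>

lemma ln_fact_eq_sum_mangoldt:
  "ln (fact n) = (\<Sum>d=1..n. mangoldt d * real (n div d))"
proof (induction n)
  case 0
  then show ?case by simp
next
  case (Suc n)
  \<comment> \<open>The quotient \<open>n div d\<close> grows by one exactly at the divisors
    \<open>d\<close> of \<open>Suc n\<close>, so the increment is the divisor sum of
    \<open>mangoldt\<close>, which equals \<open>ln (Suc n)\<close>.\<close>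
  have "(\<Sum>d=1..Suc n. mangoldt d * real (Suc n div d)) =
        (\<Sum>d=1..Suc n. mangoldt d * real (n div d) + (if d dvd Suc n then mangoldt d else 0))"
    by (intro sum.cong refl) (auto simp: div_Suc algebra_simps mod_eq_0_iff_dvd)
  also have "\<dots> = (\<Sum>d=1..Suc n. mangoldt d * real (n div d)) +
                  (\<Sum>d | d \<in> {1..Suc n} \<and> d dvd Suc n. mangoldt d)"
    by (simp only: sum.distrib sum.inter_filter finite_atLeastAtMost)
  also have "{d. d \<in> {1..Suc n} \<and> d dvd Suc n} = {d. d dvd Suc n}"
    by (auto dest: dvd_imp_le dvd_pos_nat[rotated] simp: Suc_le_eq)
  also have "(\<Sum>d | d dvd Suc n. mangoldt d) = ln (real (Suc n))"
    using mangoldt_sum[of "Suc n", where ?'a = real] by simp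
  also have "(\<Sum>d=1..Suc n. mangoldt d * real (n div d)) = ln (fact n)"
    using Suc by simp
  finally show ?case
    by (simp add: ln_mult del: of_nat_Suc)
qed

lemma ln_central_binomial_le: "ln (fact (2 * m)) - 2 * ln (fact m) \<le> 2 * real m * ln 2"
proof -
  have "real (2 * m choose m) \<le> 2 ^ (2 * m)"
    by (metis binomial_le_pow2 of_nat_le_iff of_nat_numeral of_nat_power)
  moreover have "real (2 * m choose m) = fact (2 * m) / (fact m * fact m)"
    by (simp add: binomial_fact)
  ultimately have "ln (fact (2 * m) / (fact m * fact m)) \<le> ln ((2::real) ^ (2 * m))"
    by (intro ln_mono) auto
  then show ?thesis
    by (simp add: ln_div ln_mult ln_realpow)
qed

text \<open>Chebyshev's argument: the integer \<open>2 * m div d - 2 * (m div d)\<close> is never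
  negative and equals 1 for \<open>m < d <= 2 * m\<close>, while its sum weighted by
  \<open>mangoldt\<close> is the logarithm of the central binomial coefficient.\<close>

lemma sum_mangoldt_doubling:
  "(\<Sum>d=1..2*m. mangoldt d) \<le> (\<Sum>d=1..m. mangoldt d) + 2 * real m * ln 2"
proof -
  have sub: "(\<Sum>d=1..m. mangoldt d * real (m div d)) = (\<Sum>d=1..2*m. mangoldt d * real (m div d))"
    by (rule sum.mono_neutral_left) auto
  have split: "(\<Sum>d=1..2*m. mangoldt d) = (\<Sum>d=1..m. mangoldt d) + (\<Sum>d\<in>{m<..2*m}. mangoldt d :: real)"
    by (subst sum.union_disjoint [symmetric]) (auto intro!: sum.cong)
  have "(\<Sum>d\<in>{m<..2*m}. mangoldt d :: real)
      = (\<Sum>d\<in>{m<..2*m}. mangoldt d * (real (2 * m div d) - 2 * real (m div d)))"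
  proof (intro sum.cong refl)
    fix d assume d: "d \<in> {m<..2*m}"
    then have "2 * m div d = 1"
      by (intro div_nat_eqI) auto
    with d show "(mangoldt d :: real) = mangoldt d * (real (2 * m div d) - 2 * real (m div d))"
      by simp
  qed
  also have "\<dots> \<le> (\<Sum>d\<in>{1..2*m}. mangoldt d * (real (2 * m div d) - 2 * real (m div d)))"
  proof (rule sum_mono2)
    fix d
    have "2 * (m div d) \<le> 2 * m div d"
      by (cases "d = 0") (auto simp: less_eq_div_iff_mult_less_eq mult.assoc)
    then have "2 * real (m div d) \<le> real (2 * m div d)"
      by linarith
    then show "0 \<le> (mangoldt d :: real) * (real (2 * m div d) - 2 * real (m div d))"
      by (simp add: mangoldt_nonneg)
  qed auto
  also have "\<dots> = ln (fact (2 * m)) - 2 * ln (fact m)"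
    unfolding ln_fact_eq_sum_mangoldt sub
    by (simp add: sum_subtractf sum_distrib_left algebra_simps)
  also have "\<dots> \<le> 2 * real m * ln 2"
    by (rule ln_central_binomial_le)
  finally show ?thesis
    using split by simp
qed

text \<open>Strong induction by halving: with \<open>m = n div 2\<close>, the bound
  \<open>4 * m\<close> for the first half, at most \<open>2 * m\<close> from the doubling and at
  most \<open>2 * m\<close> from the term at \<open>2 * m + 1\<close> add up to
  \<open>8 * m <= 4 * n\<close>.\<close>

lemma sum_mangoldt_le: "(\<Sum>d=1..n. mangoldt d) \<le> 4 * real n"
proof (induction n rule: less_induct)
  case (less n)
  show ?case
  proof (cases "n \<le> 1")
    case True
    then have "n = 0 \<or> n = 1" by auto
    then show ?thesis by auto
  next
    case False
    define m where "m = n div 2"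
    have m: "m < n" "0 < m" "2 * m \<le> n" "n \<le> Suc (2 * m)"
      using False unfolding m_def by auto
    have "(\<Sum>d=1..n. mangoldt d :: real) \<le> (\<Sum>d=1..Suc (2 * m). mangoldt d)"
      using m by (intro sum_mono2) (auto simp: mangoldt_nonneg)
    also have "\<dots> = (\<Sum>d=1..2*m. mangoldt d) + mangoldt (Suc (2 * m))"
      by simp
    also have "mangoldt (Suc (2 * m)) \<le> ln (real (Suc (2 * m)))"
      by (rule mangoldt_le) auto
    also have "\<dots> \<le> 2 * real m"
      using ln_add_one_self_le_self[of "2 * real m"] by (simp add: add.commute)
    also have "(\<Sum>d=1..2*m. mangoldt d) \<le> (\<Sum>d=1..m. mangoldt d) + 2 * real m * ln 2"
      by (rule sum_mangoldt_doubling)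
    also have "(\<Sum>d=1..m. mangoldt d :: real) \<le> 4 * real m"
      using less m by simp
    also have "2 * real m * ln 2 \<le> 2 * real m * 1"
      by (intro mult_left_mono) (auto intro: less_imp_le ln_2_less_1)
    finally have "(\<Sum>d=1..n. mangoldt d :: real) \<le> 8 * real m" by simp
    also have "\<dots> \<le> 4 * real n" using m by simp
    finally show ?thesis .
  qed
qed

lemma ln_fact_ge: "ln (fact n) \<ge> real n * ln (real n) - real n"
proof (induction n)
  case (Suc n)
  show ?case
  proof (cases "n = 0")
    case False
    have "ln (real (Suc n) / real n) \<le> real (Suc n) / real n - 1"
      using False by (intro ln_le_minus_one) auto
    then have "real n * (ln (real (Suc n)) - ln (real n)) \<le> 1"
      using False by (simp add: ln_div field_simps)
    then show ?thesis
      using Suc by (simp add: ln_mult distrib_right right_diff_distrib del: of_nat_Suc) (simp add: algebra_simps)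
  qed simp
qed simp

lemma ln_fact_le: "ln (fact n) \<le> real n * ln (real n)"
proof (cases "n = 0")
  case False
  have "(fact n :: real) \<le> real n ^ n"
    using fact_le_power[of n, where ?'a = real] by simp
  then have "ln (fact n :: real) \<le> ln (real n ^ n)"
    using False by (intro ln_mono) auto
  then show ?thesis
    using False by (simp add: ln_realpow)
qed simp

text \<open>Mertens' first theorem. Replacing \<open>n div d\<close> by \<open>n / d\<close> in the
  formula for \<open>ln (fact n)\<close> raises each coefficient by at most 1, so by Chebyshev's
  bound the total change is at most \<open>4 * n\<close>; then divide by \<open>n\<close>.\<close>

lemma sum_mangoldt_over_n:
  assumes "n > 0"
  shows "\<bar>(\<Sum>d=1..n. mangoldt d / real d) - ln (real n)\<bar> \<le> 4"
proof -
  let ?A = "\<Sum>d=1..n. mangoldt d / real d"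
  have "ln (fact n) \<le> (\<Sum>d=1..n. mangoldt d * (real n / real d))"
    unfolding ln_fact_eq_sum_mangoldt
    by (intro sum_mono mult_left_mono mangoldt_nonneg) (metis of_nat_div_le_of_nat)
  also have "\<dots> = real n * ?A"
    by (simp add: sum_distrib_left mult_ac)
  finally have "real n * (ln (real n) - 1) \<le> real n * ?A"
    using ln_fact_ge[of n] by (simp add: algebra_simps)
  then have lower: "ln (real n) - 1 \<le> ?A"
    using assms by simp
  have "real n * ?A - (\<Sum>d=1..n. mangoldt d) = (\<Sum>d=1..n. mangoldt d * (real n / real d - 1))"
    by (simp add: sum_distrib_left algebra_simps sum_subtractf)
  also have "\<dots> \<le> ln (fact n)"
    unfolding ln_fact_eq_sum_mangoldt
  proof (intro sum_mono mult_left_mono mangoldt_nonneg)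
    fix d
    show "real n / real d - 1 \<le> real (n div d)"
      by (cases "d = 0") (auto simp: of_nat_of_nat_div_aux[of n d] divide_le_eq_1 less_imp_le)
  qed
  finally have "real n * ?A \<le> real n * (ln (real n) + 4)"
    using ln_fact_le[of n] sum_mangoldt_le[of n] by (simp add: algebra_simps)
  then have "?A \<le> ln (real n) + 4"
    using assms by simp
  with lower show ?thesis by linarith
qed

text \<open>This is \<open>ln y <= y - 1\<close> at \<open>y = ln n / ln (Suc n)\<close>. Summed
  over \<open>n\<close>, the right-hand side telescopes to the \<open>ln ln\<close> main term of
  Mertens' second theorem.\<close>

lemma ln_ln_diff_ge:
  assumes "n \<ge> 2"
  shows "(ln (real (Suc n)) - ln (real n)) / ln (real (Suc n))
          \<le> ln (ln (real (Suc n))) - ln (ln (real n))"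
proof -
  have pos: "ln (real n) > 0" "ln (real (Suc n)) > 0" using assms by auto
  have "ln (ln (real n) / ln (real (Suc n))) \<le> ln (real n) / ln (real (Suc n)) - 1"
    using pos by (intro ln_le_minus_one) auto
  then show ?thesis
    using pos by (simp add: ln_div diff_divide_distrib)
qed

text \<open>The correction terms \<open>(E n - 4) / ln n + 8 / ln m\<close> turn the summation by parts into an induction on \<open>n\<close>.\<close>
lemma sum_mangoldt_over_n_ln_aux:
  assumes "m \<ge> 2" "m \<le> n"
  defines "E \<equiv> \<lambda>n. (\<Sum>d=1..n. mangoldt d / real d) - ln (real n)"
  shows "(\<Sum>d\<in>{m<..n}. mangoldt d / (real d * ln (real d)))
          \<le> ln (ln (real n)) - ln (ln (real m)) + (E n - 4) / ln (real n) + 8 / ln (real m)"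
  using assms(2)
proof (induction n rule: dec_induct)
  case base
  have "\<bar>E m\<bar> \<le> 4" unfolding E_def using assms(1) by (intro sum_mangoldt_over_n) auto
  moreover have "ln (real m) > 0" using assms(1) by simp
  ultimately show ?case
    by (simp add: add_divide_distrib[symmetric])
next
  case (step n)
  have pos: "ln (real n) > 0" "ln (real (Suc n)) > 0" using assms step by auto
  have le: "1 / ln (real (Suc n)) \<le> 1 / ln (real n)"
    using pos assms step by (intro divide_left_mono) auto
  have E: "\<bar>E n\<bar> \<le> 4" unfolding E_def using assms(1) step by (intro sum_mangoldt_over_n) auto
  have rec: "mangoldt (Suc n) / real (Suc n) = E (Suc n) - E n + (ln (real (Suc n)) - ln (real n))"
    unfolding E_def by simp
  have "{m<..Suc n} = insert (Suc n) {m<..n}" using step by auto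
  then have "(\<Sum>d\<in>{m<..Suc n}. mangoldt d / (real d * ln (real d)))
     = mangoldt (Suc n) / real (Suc n) / ln (real (Suc n)) + (\<Sum>d\<in>{m<..n}. mangoldt d / (real d * ln (real d)))"
    by (simp del: of_nat_Suc)
  also have "mangoldt (Suc n) / real (Suc n) / ln (real (Suc n)) =
     (E (Suc n) - 4) / ln (real (Suc n)) + (4 - E n) * (1 / ln (real (Suc n))) +
     (ln (real (Suc n)) - ln (real n)) / ln (real (Suc n))"
    unfolding rec by (simp add: add_divide_distrib diff_divide_distrib del: of_nat_Suc)
  \<comment> \<open>The shift by 4 makes \<open>4 - E n\<close> nonnegative, so
    \<open>1 / ln\<close> may be taken at \<open>n\<close> instead of \<open>Suc n\<close>; the term
    then cancels the correction in the induction hypothesis.\<close>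
  also have "(4 - E n) * (1 / ln (real (Suc n))) \<le> (4 - E n) * (1 / ln (real n))"
    using E by (intro mult_left_mono le) auto
  also have "(4 - E n) * (1 / ln (real n)) = - ((E n - 4) / ln (real n))"
    by (simp add: diff_divide_distrib)
  also note ln_ln_diff_ge[of n]
  also note step.IH
  finally show ?case using assms step by simp
qed

text \<open>At a prime \<open>mangoldt p = ln p\<close>, and all other \<open>d\<close> contribute
  nonnegative terms, so the weighted sum over all \<open>d\<close> is an upper bound. Its boundary
  term at \<open>n\<close> is nonpositive by Mertens' first theorem.\<close>

lemma sum_prime_reciprocals_le:
  assumes "m \<ge> 2" "m \<le> n"
  shows "(\<Sum>p | prime p \<and> p \<in> {m<..n}. 1 / real p)
          \<le> ln (ln (real n) / ln (real m)) + 8 / ln (real m)"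
proof -
  let ?E = "(\<Sum>d=1..n. mangoldt d / real d) - ln (real n)"
  have "(\<Sum>p | prime p \<and> p \<in> {m<..n}. 1 / real p)
      = (\<Sum>p | prime p \<and> p \<in> {m<..n}. mangoldt p / (real p * ln (real p)))"
    by (intro sum.cong refl) (use assms in auto)
  also have "\<dots> \<le> (\<Sum>p\<in>{m<..n}. mangoldt p / (real p * ln (real p)))"
    using assms by (intro sum_mono2) (auto simp: mangoldt_nonneg)
  also have "\<dots> \<le> ln (ln (real n)) - ln (ln (real m)) + (?E - 4) / ln (real n) + 8 / ln (real m)"
    by (rule sum_mangoldt_over_n_ln_aux[OF assms])
  also have "\<bar>?E\<bar> \<le> 4" using assms by (intro sum_mangoldt_over_n) auto
  then have "(?E - 4) / ln (real n) \<le> 0"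
    using assms by (intro divide_nonpos_nonneg) auto
  finally show ?thesis using assms by (simp add: ln_div)
qed

text \<open>Each counted prime contributes at least \<open>ln m\<close> to Chebyshev's sum.\<close>

lemma card_primes_between_le:
  assumes "m \<ge> 2"
  shows "real (card {p. prime p \<and> p \<in> {m<..n}}) \<le> 4 * real n / ln (real m)"
proof -
  have "real (card {p. prime p \<and> p \<in> {m<..n}}) * ln (real m) = (\<Sum>p | prime p \<and> p \<in> {m<..n}. ln (real m))"
    by simp
  also have "\<dots> \<le> (\<Sum>p | prime p \<and> p \<in> {m<..n}. mangoldt p)"
    using assms by (intro sum_mono) auto
  also have "\<dots> \<le> (\<Sum>p=1..n. mangoldt p)"
    by (intro sum_mono2) (auto simp: mangoldt_nonneg)
  also have "\<dots> \<le> 4 * real n"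
    by (rule sum_mangoldt_le)
  finally show ?thesis
    using assms by (simp add: field_simps)
qed

section \<open>Unit fractions from binary expansions, and the primes in denominators\<close>

lemma dyadic_egyptian_fraction:
  fixes q t T :: nat
  assumes "t < 2 ^ T" "q > 0"
  obtains A where "finite A" "(\<Sum>n\<in>A. 1 / real n) = real t / (real q * 2 ^ T)"
    "\<And>n. n \<in> A \<Longrightarrow> \<exists>i\<le>T. n = q * 2 ^ i" "\<And>n. n \<in> A \<Longrightarrow> q * 2 ^ T \<le> n * t"
proof
  \<comment> \<open>A binary digit 1 of \<open>t\<close> at place \<open>j\<close> contributes
    \<open>2 ^ j / (q * 2 ^ T) = 1 / (q * 2 ^ (T - j))\<close>, a unit fraction because
    \<open>j < T\<close>.\<close>
  define J where "J = set_decode t"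
  have fin: "finite J" unfolding J_def by simp
  have t: "t = (\<Sum>j\<in>J. 2 ^ j)"
    using set_decode_inverse[of t] unfolding J_def set_encode_def by simp
  have pow: "2 ^ j \<le> t" if "j \<in> J" for j
    unfolding t by (rule member_le_sum) (use that fin in auto)
  have le: "j < T" if "j \<in> J" for j
    using pow[OF that] assms(1) by (meson le_less_trans power_less_imp_less_exp one_less_numeral_iff semiring_norm(76))
  let ?A = "(\<lambda>j. q * 2 ^ (T - j)) ` J"
  show "finite ?A" using fin by simp
  have inj: "inj_on (\<lambda>j. q * 2 ^ (T - j)) J"
  proof (rule inj_onI)
    fix i j assume ij: "i \<in> J" "j \<in> J" "q * 2 ^ (T - i) = q * 2 ^ (T - j)"
    then have "T - i = T - j" using assms(2) by simp
    then show "i = j" using le[OF ij(1)] le[OF ij(2)] by simp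
  qed
  have "(\<Sum>n\<in>?A. 1 / real n) = (\<Sum>j\<in>J. 1 / real (q * 2 ^ (T - j)))"
    using inj by (simp add: sum.reindex)
  also have "\<dots> = (\<Sum>j\<in>J. 2 ^ j / (real q * 2 ^ T))"
  proof (rule sum.cong[OF refl])
    fix j assume "j \<in> J"
    then have "(2::real) ^ T = 2 ^ (T - j) * 2 ^ j"
      using le by (simp add: power_add[symmetric] less_imp_le)
    then show "1 / real (q * 2 ^ (T - j)) = 2 ^ j / (real q * 2 ^ T)"
      by simp
  qed
  also have "\<dots> = real t / (real q * 2 ^ T)"
    unfolding t by (simp add: sum_divide_distrib)
  finally show "(\<Sum>n\<in>?A. 1 / real n) = real t / (real q * 2 ^ T)" .
  show "\<exists>i\<le>T. n = q * 2 ^ i" if "n \<in> ?A" for n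
    using that diff_le_self by blast
  show "q * 2 ^ T \<le> n * t" if "n \<in> ?A" for n
  proof -
    from that obtain j where j: "j \<in> J" "n = q * 2 ^ (T - j)" by auto
    then have "q * 2 ^ T = n * 2 ^ j"
      using le[OF j(1)] by (simp add: power_add[symmetric] less_imp_le)
    then show ?thesis using pow[OF j(1)] by simp
  qed
qed

text \<open>Division with remainder, \<open>N = D * a + b\<close>, splits the fraction into
  \<open>a / 2 ^ T\<close> and \<open>b / (D * 2 ^ T)\<close>. The first part uses denominators at
  most \<open>2 ^ T\<close>. Since \<open>b < D\<close>, each term of the second part is less than
  \<open>1 / 2 ^ T\<close>, so the two families are disjoint.\<close>

lemma egyptian_fraction_of_dyadic_multiple:
  fixes D T N :: nat
  assumes "D > 0" "D \<le> 2 ^ T" "N < D * 2 ^ T"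
  obtains A where "finite A" "(\<Sum>n\<in>A. 1 / real n) = real N / (real D * 2 ^ T)"
    "\<And>n. n \<in> A \<Longrightarrow> n dvd D * 2 ^ T"
proof -
  define a b where "a = N div D" and "b = N mod D"
  have "a < 2 ^ T" unfolding a_def using assms by (simp add: less_mult_imp_div_less mult.commute)
  then obtain A where A: "finite A" "(\<Sum>n\<in>A. 1 / real n) = real a / (real 1 * 2 ^ T)"
    "\<And>n. n \<in> A \<Longrightarrow> \<exists>i\<le>T. n = 1 * 2 ^ i"
    using dyadic_egyptian_fraction[of a T 1] by (metis zero_less_one)
  have b: "b < D" unfolding b_def using assms by simp
  then obtain B where B: "finite B" "(\<Sum>n\<in>B. 1 / real n) = real b / (real D * 2 ^ T)"
    "\<And>n. n \<in> B \<Longrightarrow> \<exists>i\<le>T. n = D * 2 ^ i" "\<And>n. n \<in> B \<Longrightarrow> D * 2 ^ T \<le> n * b"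
    using dyadic_egyptian_fraction[of b T D] assms by (metis less_le_trans)
  have "A \<inter> B = {}"
  proof (rule ccontr)
    assume "A \<inter> B \<noteq> {}"
    then obtain n where n: "n \<in> A" "n \<in> B" by auto
    from A(3)[OF n(1)] have "n \<le> 2 ^ T" by auto
    moreover have "n > 0" using A(3)[OF n(1)] by auto
    ultimately have "n * b < 2 ^ T * D" using b by (intro mult_le_less_imp_less) auto
    with B(4)[OF n(2)] show False by (simp add: mult.commute)
  qed
  then have "(\<Sum>n\<in>A \<union> B. 1 / real n) = real a / 2 ^ T + real b / (real D * 2 ^ T)"
    using A B by (simp add: sum.union_disjoint)
  also have "\<dots> = (real a * real D + real b) / (real D * 2 ^ T)"
    using assms by (simp add: field_simps)
  also have "real a * real D + real b = real (a * D + b)" by simp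
  also have "a * D + b = N" unfolding a_def b_def by simp
  finally have "(\<Sum>n\<in>A \<union> B. 1 / real n) = real N / (real D * 2 ^ T)" .
  moreover have "n dvd D * 2 ^ T" if "n \<in> A \<union> B" for n
    using that
  proof
    assume "n \<in> A"
    then show ?thesis using A(3)[of n] by (auto simp: le_imp_power_dvd)
  next
    assume "n \<in> B"
    then show ?thesis using B(3)[of n] by (auto simp: le_imp_power_dvd)
  qed
  ultimately show ?thesis
    using A(1) B(1) by (intro that[of "A \<union> B"]) auto
qed

text \<open>With \<open>N\<close> the given integer, subtracting \<open>t / (p * 2 ^ T)\<close> from
  \<open>X\<close> turns \<open>N\<close> into \<open>N - D * t\<close>. As \<open>D\<close> is
  invertible modulo \<open>p\<close>, some \<open>t < p\<close> makes this divisible by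
  \<open>p\<close>, and the binary expansion of \<open>t\<close> supplies the unit
  fractions.\<close>

lemma remove_prime_from_denominator:
  fixes p D T :: nat and X :: real
  assumes "prime p" "coprime D p" "p < 2 ^ T" "X * real p * real D * 2 ^ T \<in> \<int>"
  obtains A where "finite A" "(\<Sum>n\<in>A. 1 / real n) \<le> 1 / 2 ^ T"
    "\<And>n. n \<in> A \<Longrightarrow> \<exists>i\<le>T. n = p * 2 ^ i"
    "(X - (\<Sum>n\<in>A. 1 / real n)) * real D * 2 ^ T \<in> \<int>"
proof -
  obtain N where N: "X * real p * real D * 2 ^ T = of_int N"
    using assms(4) by (auto elim: Ints_cases)
  have p: "p > 0" using assms(1) by (simp add: prime_gt_0_nat)
  obtain y where y: "[int D * y = 1] (mod int p)"
    using assms(2) cong_solve_coprime_int[of "int D" "int p"] by auto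
  define t where "t = nat ((N * y) mod int p)"
  have t: "int t = (N * y) mod int p" "t < p"
    using p unfolding t_def by (auto simp: nat_less_iff)
  have "[int D * int t = int D * (N * y)] (mod int p)"
    unfolding t by (intro cong_mult cong_refl) (simp add: cong_def)
  also have "int D * (N * y) = N * (int D * y)" by simp
  also have "[N * (int D * y) = N * 1] (mod int p)"
    by (intro cong_mult cong_refl y)
  finally have "int p dvd N - int D * int t"
    by (simp add: cong_iff_dvd_diff dvd_diff_commute)
  then obtain c where c: "N - int D * int t = int p * c" by (auto elim: dvdE)
  obtain A where A: "finite A" "(\<Sum>n\<in>A. 1 / real n) = real t / (real p * 2 ^ T)"
    "\<And>n. n \<in> A \<Longrightarrow> \<exists>i\<le>T. n = p * 2 ^ i"
    using dyadic_egyptian_fraction[of t T p] t assms p by (metis less_trans)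
  show ?thesis
  proof (rule that[OF A(1) _ A(3)])
    show "(\<Sum>n\<in>A. 1 / real n) \<le> 1 / 2 ^ T"
      unfolding A(2) using t p by (simp add: field_simps)
    have "(X - (\<Sum>n\<in>A. 1 / real n)) * real D * 2 ^ T * real p =
          X * real p * real D * 2 ^ T - real D * real t"
      unfolding A(2) using p by (simp add: field_simps)
    also have "\<dots> = of_int (N - int D * int t)" unfolding N by simp
    also have "\<dots> = of_int c * real p" unfolding c by simp
    finally have "(X - (\<Sum>n\<in>A. 1 / real n)) * real D * 2 ^ T = of_int c"
      using p by simp
    then show "(X - (\<Sum>n\<in>A. 1 / real n)) * real D * 2 ^ T \<in> \<int>" by simp
  qed
qed

text \<open>The primes are removed one at a time, the product of those still present being counted
  as part of \<open>D\<close>. Different primes never share a denominator, because \<open>p\<close>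
  is the only odd prime dividing \<open>p * 2 ^ i\<close> when \<open>i\<close> is
  arbitrary.\<close>

lemma remove_primes_from_denominator:
  fixes Q :: "nat set" and D T :: nat and X :: real
  assumes "finite Q" "\<And>p. p \<in> Q \<Longrightarrow> prime p \<and> odd p \<and> coprime D p \<and> p < 2 ^ T"
    "X * real (\<Prod>Q) * real D * 2 ^ T \<in> \<int>"
  shows "\<exists>A. finite A \<and> (\<Sum>n\<in>A. 1 / real n) \<le> real (card Q) / 2 ^ T \<and>
    (\<forall>n\<in>A. \<exists>p\<in>Q. \<exists>i\<le>T. n = p * 2 ^ i) \<and>
    (X - (\<Sum>n\<in>A. 1 / real n)) * real D * 2 ^ T \<in> \<int>"
  using assms
proof (induction Q arbitrary: X rule: finite_induct)
  case empty
  then show ?case by (intro exI[of _ "{}"]) auto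
next
  case (insert p Q)
  have p: "prime p" "odd p" "coprime D p" "p < 2 ^ T" using insert by auto
  have "coprime (\<Prod>Q) p"
    using insert p by (intro prod_coprime_left) (metis insertCI primes_coprime)
  then have "coprime (D * \<Prod>Q) p" using p by simp
  moreover have "X * real p * real (D * \<Prod>Q) * 2 ^ T \<in> \<int>"
    using insert by (simp add: mult_ac)
  ultimately obtain A where A: "finite A" "(\<Sum>n\<in>A. 1 / real n) \<le> 1 / 2 ^ T"
    "\<And>n. n \<in> A \<Longrightarrow> \<exists>i\<le>T. n = p * 2 ^ i"
    "(X - (\<Sum>n\<in>A. 1 / real n)) * real (D * \<Prod>Q) * 2 ^ T \<in> \<int>"
    using remove_prime_from_denominator p by metis
  define Y where "Y = X - (\<Sum>n\<in>A. 1 / real n)"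
  have "Y * real (\<Prod>Q) * real D * 2 ^ T \<in> \<int>"
    using A(4) unfolding Y_def by (simp add: mult_ac)
  then obtain B where B: "finite B" "(\<Sum>n\<in>B. 1 / real n) \<le> real (card Q) / 2 ^ T"
    "\<forall>n\<in>B. \<exists>q\<in>Q. \<exists>i\<le>T. n = q * 2 ^ i"
    "(Y - (\<Sum>n\<in>B. 1 / real n)) * real D * 2 ^ T \<in> \<int>"
    using insert by (metis insertCI)
  have "A \<inter> B = {}"
  proof (rule ccontr)
    assume "A \<inter> B \<noteq> {}"
    then obtain n where n: "n \<in> A" "n \<in> B" by auto
    obtain i where i: "n = p * 2 ^ i" using A(3)[OF n(1)] by auto
    obtain q j where q: "q \<in> Q" "n = q * 2 ^ j" using B(3) n(2) by blast
    have "p dvd q * 2 ^ j" using i q by (metis dvd_triv_left)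
    moreover have "\<not> p dvd 2 ^ j"
      using p by (metis prime_dvd_power primes_dvd_imp_eq two_is_prime_nat even_numeral)
    ultimately have "p dvd q" using p(1) by (simp add: prime_dvd_mult_iff)
    moreover have "prime q" using insert q by auto
    ultimately have "p = q" using p(1) by (simp add: primes_dvd_imp_eq)
    with q insert show False by simp
  qed
  then have sum: "(\<Sum>n\<in>A \<union> B. 1 / real n) = (\<Sum>n\<in>A. 1 / real n) + (\<Sum>n\<in>B. 1 / real n)"
    using A B by (simp add: sum.union_disjoint)
  show ?case
  proof (intro exI[of _ "A \<union> B"] conjI)
    show "finite (A \<union> B)" using A B by simp
    show "(\<Sum>n\<in>A \<union> B. 1 / real n) \<le> real (card (insert p Q)) / 2 ^ T"
      unfolding sum using A(2) B(2) insert by (simp add: add_divide_distrib)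
    show "\<forall>n\<in>A \<union> B. \<exists>q\<in>insert p Q. \<exists>i\<le>T. n = q * 2 ^ i"
      using A(3) B(3) by blast
    show "(X - (\<Sum>n\<in>A \<union> B. 1 / real n)) * real D * 2 ^ T \<in> \<int>"
      unfolding sum using B(4) unfolding Y_def by (simp add: algebra_simps)
  qed
qed

text \<open>The bound \<open>upper\<close> leaves room for the corrections, so the final remainder
  is nonnegative; \<open>lower\<close> keeps it below 1, so its numerator over
  \<open>D * 2 ^ T\<close> is in the range of the dyadic representation. The corrections avoid
  \<open>S\<^sub>0\<close> by size, and they avoid the final terms because no \<open>p\<close> in
  \<open>Q\<close> divides \<open>D * 2 ^ T\<close>.\<close>

lemma complete_to_egyptian_fraction:
  fixes S\<^sub>0 Q :: "nat set" and D T P :: nat and r :: real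
  assumes "D > 0" "D \<le> 2 ^ T" "finite Q"
    and Q: "\<And>p. p \<in> Q \<Longrightarrow> prime p \<and> odd p \<and> coprime D p \<and> p \<le> P \<and> p < 2 ^ T"
    and r: "r * real D \<in> \<int>"
    and S\<^sub>0: "finite S\<^sub>0" "\<And>n. n \<in> S\<^sub>0 \<Longrightarrow> n > D * 2 ^ T \<and> n > P * 2 ^ T \<and> n dvd D * \<Prod>Q"
    and upper: "(\<Sum>n\<in>S\<^sub>0. 1 / real n) \<le> r - real (card Q) / 2 ^ T"
    and lower: "r - 1 < (\<Sum>n\<in>S\<^sub>0. 1 / real n)"
  obtains S where "S\<^sub>0 \<subseteq> S" "finite S" "r = (\<Sum>n\<in>S. 1 / real n)"
    "\<And>n. n \<in> S - S\<^sub>0 \<Longrightarrow> 0 < n \<and> n \<le> max (D * 2 ^ T) (P * 2 ^ T)"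
proof -
  define X where "X = r - (\<Sum>n\<in>S\<^sub>0. 1 / real n)"
  \<comment> \<open>Every \<open>n\<close> in \<open>S\<^sub>0\<close> divides
    \<open>D * \<Prod>Q\<close>, so this product is a common denominator for the sum, and
    \<open>D\<close> clears \<open>r\<close>.\<close>
  have "X * real (\<Prod>Q) * real D * 2 ^ T =
      (r * real D) * of_nat (\<Prod>Q) * of_nat (2 ^ T) - (\<Sum>n\<in>S\<^sub>0. real (D * \<Prod>Q) / real n) * of_nat (2 ^ T)"
    unfolding X_def by (simp add: algebra_simps sum_distrib_left)
  also have "\<dots> \<in> \<int>"
  proof (intro Ints_diff Ints_mult[OF Ints_mult[OF r Ints_of_nat] Ints_of_nat]
      Ints_mult[OF Ints_sum Ints_of_nat])
    fix n assume "n \<in> S\<^sub>0"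
    then have "real (D * \<Prod>Q) / real n = real (D * \<Prod>Q div n)"
      using S\<^sub>0(2) by (simp add: real_of_nat_div del: of_nat_mult)
    then show "real (D * \<Prod>Q) / real n \<in> \<int>" by simp
  qed
  finally have "X * real (\<Prod>Q) * real D * 2 ^ T \<in> \<int>" .
  then obtain A where A: "finite A" "(\<Sum>n\<in>A. 1 / real n) \<le> real (card Q) / 2 ^ T"
    "\<forall>n\<in>A. \<exists>p\<in>Q. \<exists>i\<le>T. n = p * 2 ^ i" "(X - (\<Sum>n\<in>A. 1 / real n)) * real D * 2 ^ T \<in> \<int>"
    using remove_primes_from_denominator[of Q D T X] assms(3) Q by blast
  define R where "R = X - (\<Sum>n\<in>A. 1 / real n)"
  have "R \<ge> 0" unfolding R_def X_def using A(2) upper by simp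
  have "R \<le> X" unfolding R_def by (simp add: sum_nonneg)
  also have "X < 1" using lower unfolding X_def by simp
  finally have "R < 1" .
  obtain N' where N': "R * real D * 2 ^ T = of_int N'"
    using A(4) unfolding R_def by (auto elim: Ints_cases)
  have "N' \<ge> 0"
    using \<open>R \<ge> 0\<close> N' by (metis mult_nonneg_nonneg of_nat_0_le_iff of_int_0_le_iff zero_le_numeral zero_le_power)
  define N where "N = nat N'"
  have N: "R * real D * 2 ^ T = real N" using N' \<open>N' \<ge> 0\<close> unfolding N_def by simp
  have "R * (real D * 2 ^ T) < 1 * (real D * 2 ^ T)"
    using \<open>R < 1\<close> assms(1) by (intro mult_strict_right_mono) auto
  then have "real N < real (D * 2 ^ T)" using N by (simp add: mult.assoc)
  then have "N < D * 2 ^ T" by (simp only: of_nat_less_iff)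
  then obtain B where B: "finite B" "(\<Sum>n\<in>B. 1 / real n) = real N / (real D * 2 ^ T)"
    "\<And>n. n \<in> B \<Longrightarrow> n dvd D * 2 ^ T"
    using egyptian_fraction_of_dyadic_multiple assms by metis
  have BR: "(\<Sum>n\<in>B. 1 / real n) = R"
    unfolding B(2) using N assms(1) by (simp add: field_simps)
  have Ale: "0 < n \<and> n \<le> P * 2 ^ T" if n: "n \<in> A" for n
  proof -
    from A(3) n obtain p i where p: "p \<in> Q" "i \<le> T" "n = p * 2 ^ i" by blast
    then show ?thesis using Q[OF p(1)] by (auto intro!: mult_le_mono simp: prime_gt_0_nat)
  qed
  have Ble: "0 < n \<and> n \<le> D * 2 ^ T" if n: "n \<in> B" for n
    using B(3)[OF n] assms(1) by (auto dest: dvd_imp_le intro!: Nat.gr0I)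
  have "A \<inter> B = {}"
  proof (rule ccontr)
    assume "A \<inter> B \<noteq> {}"
    then obtain n where n: "n \<in> A" "n \<in> B" by auto
    from A(3) n(1) obtain p i where p: "p \<in> Q" "i \<le> T" "n = p * 2 ^ i" by blast
    have "p dvd D * 2 ^ T" using B(3)[OF n(2)] p(3) by (metis dvd_mult_left)
    moreover have "\<not> p dvd D"
      using Q[OF p(1)] by (metis coprime_common_divisor dvd_refl not_prime_unit)
    moreover have "\<not> p dvd 2 ^ T"
      using Q[OF p(1)] by (metis prime_dvd_power primes_dvd_imp_eq two_is_prime_nat even_numeral)
    ultimately show False using Q[OF p(1)] by (simp add: prime_dvd_mult_iff)
  qed
  moreover have "S\<^sub>0 \<inter> (A \<union> B) = {}"
    using Ale Ble S\<^sub>0(2) by (metis Int_emptyI UnE leD)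
  ultimately have "(\<Sum>n\<in>S\<^sub>0 \<union> (A \<union> B). 1 / real n) = r"
    using S\<^sub>0(1) A(1) B(1) BR by (simp add: sum.union_disjoint R_def X_def)
  then show ?thesis
    using S\<^sub>0(1) A(1) B(1) Ale Ble by (intro that[of "S\<^sub>0 \<union> (A \<union> B)"]) (auto simp: le_max_iff_disj)
qed

text \<open>Compare one prime at a time. The full power of \<open>p\<close> in \<open>n\<close> is
  either at most \<open>K ^ 3\<close>, hence a divisor of the factorial, or a single prime above
  \<open>K ^ 3\<close>, hence a factor of the product.\<close>

lemma smooth_dvd_fact_times_primes:
  fixes n K P :: nat
  assumes "n > 0" and smooth: "\<And>p. prime p \<Longrightarrow> p dvd n \<Longrightarrow> p \<le> P"
    and squares: "\<And>d. d > K \<Longrightarrow> \<not> d\<^sup>2 dvd n"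
  shows "n dvd fact (K ^ 3) * \<Prod>{p. prime p \<and> p \<in> {K ^ 3<..P}}"
proof (rule multiplicity_le_imp_dvd)
  let ?Q = "{p. prime p \<and> p \<in> {K ^ 3<..P}}"
  show "n \<noteq> 0" using assms by simp
  have pos: "fact (K ^ 3) * \<Prod>?Q \<noteq> (0::nat)"
    using prime_gt_0_nat by (auto simp: prod_zero_iff)
  fix p :: nat assume p: "prime p"
  define e where "e = multiplicity p n"
  have dvd: "p ^ e dvd n" unfolding e_def by (rule multiplicity_dvd)
  have half: "p ^ (e div 2) \<le> K"
  proof (rule ccontr)
    assume "\<not> p ^ (e div 2) \<le> K"
    then have "\<not> (p ^ (e div 2))\<^sup>2 dvd n" by (intro squares) simp
    moreover have "(p ^ (e div 2))\<^sup>2 dvd p ^ e"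
      unfolding power_mult[symmetric] by (intro le_imp_power_dvd) simp
    ultimately show False using dvd by (meson dvd_trans)
  qed
  show "multiplicity p n \<le> multiplicity p (fact (K ^ 3) * \<Prod>?Q)"
  proof (cases "e = 0")
    case True
    then show ?thesis unfolding e_def by simp
  next
    case e: False
    have "p ^ e dvd fact (K ^ 3) * \<Prod>?Q"
    proof (cases "e \<ge> 2 \<or> p \<le> K ^ 3")
      case True
      have "p ^ e \<le> K ^ 3"
      proof (cases "e = 1")
        case True
        with \<open>e \<ge> 2 \<or> p \<le> K ^ 3\<close> show ?thesis by simp
      next
        case False
        with e have "e \<ge> 2" by simp
        then have "1 \<le> e div 2" by simp
        then have "p ^ 1 \<le> p ^ (e div 2)"
          using p by (intro power_increasing) (auto simp: prime_gt_0_nat Suc_leI)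
        then have "p \<le> K" using half by simp
        \<comment> \<open>The largest even power is a square dividing \<open>n\<close>, so it is at
          most \<open>K ^ 2\<close>; an odd exponent leaves one more factor \<open>p <= K\<close>.
          Hence the cube.\<close>
        have "p ^ e \<le> p ^ (2 * (e div 2) + 1)"
          using p by (intro power_increasing) (auto simp: prime_gt_0_nat Suc_leI)
        also have "\<dots> = (p ^ (e div 2)) ^ 2 * p" by (simp add: power_mult[symmetric] mult.commute)
        also have "\<dots> \<le> K ^ 2 * K"
          using half \<open>p \<le> K\<close> by (intro mult_le_mono power_mono) auto
        also have "\<dots> = K ^ 3" by (simp add: power2_eq_square power3_eq_cube)
        finally show ?thesis .
      qed
      then have "p ^ e dvd fact (K ^ 3)"
        using p by (intro dvd_fact) (auto simp: prime_gt_0_nat Suc_leI)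
      then show ?thesis by simp
    next
      case False
      with e have "e = 1" "p > K ^ 3" by auto
      moreover have "p \<le> P" using dvd \<open>e = 1\<close> p by (intro smooth) auto
      ultimately have "p dvd \<Prod>?Q" using p by (intro dvd_prodI) auto
      then show ?thesis using \<open>e = 1\<close> by simp
    qed
    then show ?thesis
      unfolding e_def[symmetric] using p pos by (intro multiplicity_geI) (auto simp: not_prime_unit)
  qed
qed

section \<open>Counting smooth integers in intervals and selecting from them\<close>

definition nats_between :: "real \<Rightarrow> real \<Rightarrow> nat set" where
  "nats_between z w = {n. z < real n \<and> real n \<le> w}"

lemma nats_between_eq:
  assumes "0 \<le> z"
  shows "nats_between z w = {nat \<lfloor>z\<rfloor><..nat \<lfloor>w\<rfloor>}"
  using assms unfolding nats_between_def by (auto; linarith)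

lemma finite_nats_between [simp]: "finite (nats_between z w)"
proof (rule finite_subset)
  show "nats_between z w \<subseteq> {..nat \<lfloor>w\<rfloor>}"
    unfolding nats_between_def by (auto; linarith)
qed simp

lemma card_nats_between:
  assumes "0 \<le> z" "z \<le> w"
  shows "w - z - 1 \<le> real (card (nats_between z w))" "real (card (nats_between z w)) \<le> w - z + 1"
proof -
  have "nat \<lfloor>z\<rfloor> \<le> nat \<lfloor>w\<rfloor>" using assms by (intro nat_mono floor_mono)
  then have "real (card (nats_between z w)) = of_int \<lfloor>w\<rfloor> - of_int \<lfloor>z\<rfloor>"
    using assms by (simp add: nats_between_eq of_nat_diff)
  then show "w - z - 1 \<le> real (card (nats_between z w))" "real (card (nats_between z w)) \<le> w - z + 1"
    by linarith+
qed

lemma card_multiples_between_le: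
  assumes "0 \<le> z" "z \<le> w" "d > 0"
  shows "real (card {n \<in> nats_between z w. d dvd n}) \<le> (w - z) / real d + 1"
proof -
  have "{n \<in> nats_between z w. d dvd n} \<subseteq> (\<lambda>k. d * k) ` nats_between (z / real d) (w / real d)"
    using assms(3) unfolding nats_between_def by (auto simp: field_simps elim!: dvdE)
  then have "card {n \<in> nats_between z w. d dvd n} \<le> card (nats_between (z / real d) (w / real d))"
    by (rule surj_card_le[OF finite_nats_between])
  also have "real \<dots> \<le> w / real d - z / real d + 1"
    using assms by (intro card_nats_between) (auto simp: divide_right_mono)
  finally show ?thesis by (simp add: diff_divide_distrib)
qed

text \<open>In the application \<open>P\<close> grows with \<open>x\<close> while \<open>K\<close>
  stays fixed. The condition on squares forces every prime above \<open>K\<close> to occur at most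
  once.\<close>

definition smooth_nats :: "nat \<Rightarrow> nat \<Rightarrow> nat set" where
  "smooth_nats P K = {n. n > 0 \<and> (\<forall>p. prime p \<longrightarrow> p dvd n \<longrightarrow> p \<le> P) \<and> (\<forall>d>K. \<not> d\<^sup>2 dvd n)}"

lemma sum_inverse_squares_le:
  assumes "K > 0"
  shows "(\<Sum>d\<in>{K<..M}. 1 / (real d)\<^sup>2) \<le> 1 / real K"
proof (cases "K \<le> M")
  case True
  then have "(\<Sum>d\<in>{K<..M}. 1 / (real d)\<^sup>2) \<le> 1 / real K - 1 / real M"
  proof (induction M rule: dec_induct)
    case (step M)
    have "{K<..Suc M} = insert (Suc M) {K<..M}" using step by auto
    then have "(\<Sum>d\<in>{K<..Suc M}. 1 / (real d)\<^sup>2) = 1 / (real (Suc M))\<^sup>2 + (\<Sum>d\<in>{K<..M}. 1 / (real d)\<^sup>2)"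
      by simp
    also have "1 / (real (Suc M))\<^sup>2 \<le> 1 / (real M * real (Suc M))"
      using step assms by (intro divide_left_mono) (auto simp: power2_eq_square)
    also have "\<dots> = 1 / real M - 1 / real (Suc M)"
      using step assms by (simp add: field_simps)
    also note step.IH
    finally show ?case by simp
  qed simp
  also have "\<dots> \<le> 1 / real K" by simp
  finally show ?thesis .
qed simp

text \<open>A union bound over the obstructions: primes \<open>p\<close> with
  \<open>P < p <= x\<close> and squares of \<open>d\<close> with \<open>K < d <= sqrt x\<close>. A
  modulus \<open>q\<close> has at most \<open>(w - z) / q + 1\<close> multiples in the interval. The
  reciprocals \<open>1 / q\<close> give the terms in the bracket; the summands 1 give the prime
  count and \<open>sqrt x\<close>.\<close>

lemma card_smooth_between_ge:
  fixes x z w :: real and P K :: nat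
  assumes "0 \<le> z" "z \<le> w" "w \<le> x" "P \<ge> 2" "real P \<le> x" "K > 0"
  shows "real (card (nats_between z w \<inter> smooth_nats P K)) \<ge>
    (w - z) * (1 - ln (ln x / ln (real P)) - 8 / ln (real P) - 1 / real K)
    - 4 * x / ln (real P) - sqrt x - 1"
proof -
  define I where "I = nats_between z w"
  define N where "N = nat \<lfloor>x\<rfloor>"
  define M where "M = nat \<lfloor>sqrt x\<rfloor>"
  define Q where "Q = {p. prime p \<and> p \<in> {P<..N}}"
  have x: "x \<ge> 2" using assms by linarith
  have N: "real N \<le> x" "P \<le> N" "N > 0" using assms unfolding N_def by (auto simp: le_nat_floor; linarith)+
  have lnP: "ln (real P) > 0" using assms by simp
  have finQ: "finite Q" unfolding Q_def by simp
  have "I - smooth_nats P K \<subseteq> (\<Union>p\<in>Q. {n\<in>I. p dvd n}) \<union> (\<Union>d\<in>{K<..M}. {n\<in>I. d\<^sup>2 dvd n})"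
  proof
    fix n assume n: "n \<in> I - smooth_nats P K"
    then have n': "n > 0" "real n \<le> x" using assms unfolding I_def nats_between_def by auto
    then have "n \<le> N" unfolding N_def by (simp add: le_nat_floor)
    have "(\<exists>p. prime p \<and> p dvd n \<and> p > P) \<or> (\<exists>d>K. d\<^sup>2 dvd n)"
      using n n' unfolding smooth_nats_def by (auto simp: not_le)
    then consider p where "prime p" "p dvd n" "p > P" | d where "d > K" "d\<^sup>2 dvd n"
      by blast
    then show "n \<in> (\<Union>p\<in>Q. {n\<in>I. p dvd n}) \<union> (\<Union>d\<in>{K<..M}. {n\<in>I. d\<^sup>2 dvd n})"
    proof cases
      case 1
      have "p \<le> n" using 1 n' by (simp add: dvd_imp_le)
      with 1 n \<open>n \<le> N\<close> show ?thesis unfolding Q_def by auto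
    next
      case 2
      have "d\<^sup>2 \<le> n" using 2 n' by (simp add: dvd_imp_le)
      then have "(real d)\<^sup>2 \<le> x" using n' by (metis of_nat_le_iff of_nat_power order_trans)
      then have "real d \<le> sqrt x" by (rule real_le_rsqrt)
      then have "d \<le> M" unfolding M_def by (simp add: le_nat_floor)
      with 2 n show ?thesis by auto
    qed
  qed
  then have "card (I - smooth_nats P K) \<le> card ((\<Union>p\<in>Q. {n\<in>I. p dvd n}) \<union> (\<Union>d\<in>{K<..M}. {n\<in>I. d\<^sup>2 dvd n}))"
    using finQ by (intro card_mono) (auto simp: I_def)
  also have "\<dots> \<le> (\<Sum>p\<in>Q. card {n\<in>I. p dvd n}) + (\<Sum>d\<in>{K<..M}. card {n\<in>I. d\<^sup>2 dvd n})"
    using finQ by (intro order_trans[OF card_Un_le] add_mono card_UN_le) auto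
  finally have "real (card (I - smooth_nats P K)) \<le>
      (\<Sum>p\<in>Q. real (card {n\<in>I. p dvd n})) + (\<Sum>d\<in>{K<..M}. real (card {n\<in>I. d\<^sup>2 dvd n}))"
    by (simp only: of_nat_sum[symmetric] of_nat_add[symmetric] of_nat_le_iff)
  also have "(\<Sum>p\<in>Q. real (card {n\<in>I. p dvd n})) \<le> (\<Sum>p\<in>Q. (w - z) * (1 / real p) + 1)"
  proof (rule sum_mono)
    fix p assume "p \<in> Q"
    then have "p > 0" unfolding Q_def by auto
    then show "real (card {n\<in>I. p dvd n}) \<le> (w - z) * (1 / real p) + 1"
      using card_multiples_between_le[of z w p] assms unfolding I_def by simp
  qed
  also have "\<dots> = (w - z) * (\<Sum>p\<in>Q. 1 / real p) + real (card Q)"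
    by (simp add: sum.distrib sum_distrib_left)
  also have "(w - z) * (\<Sum>p\<in>Q. 1 / real p) \<le> (w - z) * (ln (ln x / ln (real P)) + 8 / ln (real P))"
  proof (rule mult_left_mono)
    have "(\<Sum>p\<in>Q. 1 / real p) \<le> ln (ln (real N) / ln (real P)) + 8 / ln (real P)"
      unfolding Q_def using assms N by (intro sum_prime_reciprocals_le) auto
    also have "ln (ln (real N) / ln (real P)) \<le> ln (ln x / ln (real P))"
      using assms N lnP by (intro ln_mono divide_right_mono divide_pos_pos) auto
    finally show "(\<Sum>p\<in>Q. 1 / real p) \<le> ln (ln x / ln (real P)) + 8 / ln (real P)" by simp
  qed (use assms in simp)
  also have "real (card Q) \<le> 4 * real N / ln (real P)"
    unfolding Q_def using assms by (intro card_primes_between_le)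
  also have "\<dots> \<le> 4 * x / ln (real P)"
    using N lnP by (intro divide_right_mono) auto
  also have "(\<Sum>d\<in>{K<..M}. real (card {n\<in>I. d\<^sup>2 dvd n})) \<le> (\<Sum>d\<in>{K<..M}. (w - z) * (1 / (real d)\<^sup>2) + 1)"
  proof (rule sum_mono)
    fix d assume "d \<in> {K<..M}"
    then show "real (card {n\<in>I. d\<^sup>2 dvd n}) \<le> (w - z) * (1 / (real d)\<^sup>2) + 1"
      using card_multiples_between_le[of z w "d\<^sup>2"] assms unfolding I_def by simp
  qed
  also have "\<dots> = (w - z) * (\<Sum>d\<in>{K<..M}. 1 / (real d)\<^sup>2) + real (M - K)"
    by (simp add: sum.distrib sum_distrib_left)
  also have "(w - z) * (\<Sum>d\<in>{K<..M}. 1 / (real d)\<^sup>2) \<le> (w - z) * (1 / real K)"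
    using assms by (intro mult_left_mono sum_inverse_squares_le) auto
  also have "real (M - K) \<le> sqrt x"
  proof -
    have "real M \<le> sqrt x" unfolding M_def using x by simp
    then show ?thesis by linarith
  qed
  finally have bad: "real (card (I - smooth_nats P K)) \<le>
    (w - z) * (ln (ln x / ln (real P)) + 8 / ln (real P)) + 4 * x / ln (real P) + ((w - z) * (1 / real K) + sqrt x)"
    by simp
  have "card I = card (I \<inter> smooth_nats P K) + card (I - smooth_nats P K)"
    by (subst card_Un_disjoint[symmetric]) (auto simp: I_def intro!: arg_cong[of _ _ card])
  moreover have "w - z - 1 \<le> real (card I)"
    unfolding I_def using assms by (intro card_nats_between)
  ultimately show ?thesis
    using bad unfolding I_def[symmetric] by (simp add: algebra_simps)
qed

text \<open>For \<open>P\<close> near \<open>x powr a\<close> with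
  \<open>a = 1 / 2 - \<delta>\<close>, the ratio \<open>ln x / ln P\<close> tends to
  \<open>1 / a\<close>, so the density bound tends to \<open>1 + ln a - 1 / K > c\<close>. The
  remaining errors are o(x), hence negligible uniformly over intervals of length at least
  \<open>\<kappa> * x\<close>.\<close>

lemma smooth_density:
  fixes \<delta> c \<kappa> :: real and K :: nat
  assumes "0 < \<delta>" "\<delta> < 1 / 2" "K > 0" "0 < \<kappa>" "c < 1 + ln (1 / 2 - \<delta>) - 1 / real K"
  shows "\<forall>\<^sub>F x in at_top. \<forall>z w. 0 \<le> z \<longrightarrow> w \<le> x \<longrightarrow> \<kappa> * x \<le> w - z \<longrightarrow>
     c * (w - z) \<le> real (card (nats_between z w \<inter> smooth_nats (nat \<lfloor>x powr (1 / 2 - \<delta>)\<rfloor>) K))"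
proof -
  define a where "a = 1 / 2 - \<delta>"
  have a: "0 < a" "a < 1" using assms unfolding a_def by auto
  \<comment> \<open>This is the sieve bound per unit length, with \<open>P\<close> replaced by the
    smaller \<open>x powr a - 1\<close> and, in the error term, the length by
    \<open>\<kappa> * x\<close>. A function of \<open>x\<close> alone remains, free of
    floors.\<close>
  define h where "h = (\<lambda>x::real. 1 - ln (ln x / ln (x powr a - 1)) - 8 / ln (x powr a - 1) - 1 / real K
     - (4 * x / ln (x powr a - 1) + sqrt x + 1) / (\<kappa> * x))"
  have lim1: "((\<lambda>x::real. ln x / ln (x powr a - 1)) \<longlongrightarrow> inverse a) at_top"
    using a by real_asymp
  have lim2: "((\<lambda>x::real. 8 / ln (x powr a - 1)) \<longlongrightarrow> 0) at_top"
    using a by real_asymp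
  have lim3: "((\<lambda>x::real. (4 * x / ln (x powr a - 1) + sqrt x + 1) / (\<kappa> * x)) \<longlongrightarrow> 0) at_top"
    using a assms by real_asymp
  have "(h \<longlongrightarrow> 1 - ln (inverse a) - 0 - 1 / real K - 0) at_top"
    unfolding h_def using a by (intro tendsto_diff tendsto_ln lim1 lim2 lim3 tendsto_const) auto
  moreover have "1 - ln (inverse a) - 0 - 1 / real K - 0 > c"
    using assms a unfolding a_def[symmetric] by (simp add: ln_inverse)
  ultimately have "\<forall>\<^sub>F x in at_top. h x > c" by (rule order_tendstoD)
  moreover have "\<forall>\<^sub>F x::real in at_top. x powr a - 1 > 2" using a by real_asymp
  moreover have "\<forall>\<^sub>F x::real in at_top. x powr a < x" using a by real_asymp
  moreover have "\<forall>\<^sub>F x::real in at_top. x > 1" by (rule eventually_gt_at_top)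
  ultimately show ?thesis
  proof eventually_elim
    case (elim x)
    show ?case
    proof (intro allI impI)
      fix z w assume zw: "0 \<le> z" "w \<le> x" "\<kappa> * x \<le> w - z"
      define P where "P = nat \<lfloor>x powr a\<rfloor>"
      have P: "real P \<le> x powr a" "x powr a - 1 < real P"
        unfolding P_def using elim by (auto; linarith)+
      have l: "0 < ln (x powr a - 1)" "ln (x powr a - 1) \<le> ln (real P)" using elim P by auto
      then have l': "0 < ln (real P)" by linarith
      have "\<kappa> * x > 0" using assms elim by simp
      then have "w - z > 0" using zw by linarith
      have distrib: "(A - B / q) * y = y * A - B * (y / q)" for A B q y :: real
        by (simp add: algebra_simps)
      have "c * (w - z) \<le> h x * (w - z)"
        using elim \<open>w - z > 0\<close> by (intro mult_right_mono) auto
      also have "\<dots> = (w - z) * (1 - ln (ln x / ln (x powr a - 1)) - 8 / ln (x powr a - 1) - 1 / real K)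
         - (4 * x / ln (x powr a - 1) + sqrt x + 1) * ((w - z) / (\<kappa> * x))"
        unfolding h_def by (rule distrib)
      also have "\<dots> \<le> (w - z) * (1 - ln (ln x / ln (real P)) - 8 / ln (real P) - 1 / real K)
         - (4 * x / ln (real P) + sqrt x + 1) * 1"
      proof (rule diff_mono[OF mult_left_mono mult_mono])
        have "ln (ln x / ln (real P)) \<le> ln (ln x / ln (x powr a - 1))"
          using l l' P elim by (intro ln_mono divide_left_mono divide_pos_pos mult_pos_pos) auto
        moreover have "8 / ln (real P) \<le> 8 / ln (x powr a - 1)"
          using l l' P by (intro divide_left_mono mult_pos_pos) auto
        ultimately show "1 - ln (ln x / ln (x powr a - 1)) - 8 / ln (x powr a - 1) - 1 / real K
            \<le> 1 - ln (ln x / ln (real P)) - 8 / ln (real P) - 1 / real K"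
          by linarith
        have "4 * x / ln (real P) \<le> 4 * x / ln (x powr a - 1)"
          using l l' P elim by (intro divide_left_mono mult_pos_pos) auto
        then show "4 * x / ln (real P) + sqrt x + 1 \<le> 4 * x / ln (x powr a - 1) + sqrt x + 1" by simp
        show "1 \<le> (w - z) / (\<kappa> * x)" using zw \<open>\<kappa> * x > 0\<close> by simp
        show "0 \<le> 4 * x / ln (x powr a - 1) + sqrt x + 1" using l elim by auto
      qed (use \<open>w - z > 0\<close> in auto)
      also have "\<dots> \<le> real (card (nats_between z w \<inter> smooth_nats P K))"
        using card_smooth_between_ge[of z w x P K] zw \<open>w - z > 0\<close> elim P assms by simp
      finally show "c * (w - z) \<le> real (card (nats_between z w \<inter> smooth_nats (nat \<lfloor>x powr (1 / 2 - \<delta>)\<rfloor>) K))"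
        unfolding P_def a_def .
    qed
  qed
qed

text \<open>The range is cut into \<open>J\<close> geometric blocks. The ratio \<open>\<mu>\<close>
  solves \<open>c * (1 - \<mu>) / \<mu> = r / J\<close>, so a block filled with density
  \<open>c\<close> has reciprocal sum at most \<open>r / J\<close> and, up to rounding, at least
  \<open>\<mu> * r / J\<close>, wherever its elements lie. Only the counts per block matter.\<close>

lemma select_with_constant_density:
  fixes G :: "nat set" and c r x \<mu> :: real and J :: nat
  assumes "c > 0" "r > 0" "x > 0" "J > 0"
  assumes \<mu>: "\<mu> = 1 / (1 + r / c / real J)"
  assumes dense: "\<And>j. j < J \<Longrightarrow>
      c * (\<mu> ^ j * x - \<mu> ^ Suc j * x) \<le> real (card (nats_between (\<mu> ^ Suc j * x) (\<mu> ^ j * x) \<inter> G))"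
  obtains S where "S \<subseteq> nats_between (\<mu> ^ J * x) x \<inter> G" "(\<Sum>n\<in>S. 1 / real n) \<le> r"
    "\<mu> * r - real J / (\<mu> ^ J * x) \<le> (\<Sum>n\<in>S. 1 / real n)"
    "c * (1 - \<mu> ^ J) * x - real J \<le> real (card S)"
proof -
  have \<mu>01: "0 < \<mu>" "\<mu> < 1" unfolding \<mu> using assms by (auto simp: field_simps add_pos_pos)
  have ratio: "c * (1 - \<mu>) = \<mu> * r / real J"
  proof -
    have "1 + r / c / real J > 0" using assms by (simp add: add_pos_pos)
    then have "\<mu> * (1 + r / c / real J) = 1" unfolding \<mu> by simp
    then have "1 - \<mu> = \<mu> * (r / c / real J)" by (simp add: algebra_simps)
    then show ?thesis using assms by simp
  qed
  define I where "I = (\<lambda>j. nats_between (\<mu> ^ Suc j * x) (\<mu> ^ j * x))"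
  \<comment> \<open>The quota of block \<open>j\<close> is \<open>c\<close> times its length,
    rounded down. Rounding costs at most one element per block, which accounts for the two error
    terms containing \<open>J\<close>.\<close>
  define m where "m = (\<lambda>j. nat \<lfloor>c * (1 - \<mu>) * \<mu> ^ j * x\<rfloor>)"
  have m: "real (m j) \<le> c * (1 - \<mu>) * \<mu> ^ j * x" "c * (1 - \<mu>) * \<mu> ^ j * x - 1 \<le> real (m j)" for j
    unfolding m_def using assms \<mu>01 by (auto; linarith)+
  have "\<exists>B. B \<subseteq> I j \<inter> G \<and> card B = m j" if "j < J" for j
  proof -
    have "real (m j) \<le> real (card (I j \<inter> G))"
      using m(1)[of j] dense[OF that] unfolding I_def by (simp add: algebra_simps)
    then show ?thesis
      by (metis obtain_subset_with_card_n of_nat_le_iff)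
  qed
  then obtain B where B: "\<And>j. j < J \<Longrightarrow> B j \<subseteq> I j \<inter> G" "\<And>j. j < J \<Longrightarrow> card (B j) = m j"
    by metis
  have fin: "finite (B j)" if "j < J" for j
    using B(1)[OF that] unfolding I_def by (meson finite_Int finite_nats_between finite_subset)
  have disj: "B i \<inter> B j = {}" if "i < J" "j < J" "i \<noteq> j" for i j
    using that
  proof (induction i j rule: linorder_wlog)
    case (le i j)
    then have "\<mu> ^ j \<le> \<mu> ^ Suc i" using \<mu>01 by (intro power_decreasing) auto
    then have "\<mu> ^ j * x \<le> \<mu> ^ Suc i * x" using assms by (intro mult_right_mono) auto
    then have "I i \<inter> I j = {}" unfolding I_def nats_between_def by auto
    then show ?case using B(1) le by blast
  next
    case (sym i j)
    then show ?case by blast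
  qed
  define S where "S = (\<Union>j<J. B j)"
  have sumS: "(\<Sum>n\<in>S. f n) = (\<Sum>j<J. \<Sum>n\<in>B j. f n)" for f :: "nat \<Rightarrow> real"
    unfolding S_def using fin disj by (intro sum.UNION_disjoint) auto
  have n_bounds: "\<mu> ^ Suc j * x < real n" "real n \<le> \<mu> ^ j * x" if "j < J" "n \<in> B j" for j n
    using B(1)[OF that(1)] that(2) unfolding I_def nats_between_def by auto
  show ?thesis
  proof (rule that[of S])
    show "S \<subseteq> nats_between (\<mu> ^ J * x) x \<inter> G"
    proof
      fix n assume "n \<in> S"
      then obtain j where j: "j < J" "n \<in> B j" unfolding S_def by auto
      have "\<mu> ^ J * x \<le> \<mu> ^ Suc j * x"
        using j \<mu>01 assms by (intro mult_right_mono power_decreasing) auto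
      moreover have "\<mu> ^ j * x \<le> 1 * x"
        using \<mu>01 assms by (intro mult_right_mono power_le_one) auto
      ultimately show "n \<in> nats_between (\<mu> ^ J * x) x \<inter> G"
        using n_bounds[OF j] B(1)[OF j(1)] j(2) unfolding nats_between_def by auto
    qed
    have "(\<Sum>n\<in>S. 1 / real n) \<le> (\<Sum>j<J. r / real J)"
      unfolding sumS
    proof (rule sum_mono)
      fix j assume "j \<in> {..<J}"
      then have j: "j < J" by simp
      have pos: "0 < \<mu> ^ Suc j * x" using \<mu>01 assms by simp
      have "(\<Sum>n\<in>B j. 1 / real n) \<le> (\<Sum>n\<in>B j. 1 / (\<mu> ^ Suc j * x))"
      proof (intro sum_mono divide_left_mono)
        fix n assume n: "n \<in> B j"
        then have "real n > 0" using n_bounds(1)[OF j n] pos by linarith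
        then show "0 < real n * (\<mu> ^ Suc j * x)" using pos by (rule mult_pos_pos)
        show "\<mu> ^ Suc j * x \<le> real n" using n_bounds(1)[OF j n] by simp
      qed simp
      also have "\<dots> = real (m j) / (\<mu> ^ Suc j * x)" using B(2)[OF j] by simp
      also have "\<dots> \<le> (c * (1 - \<mu>) * \<mu> ^ j * x) / (\<mu> ^ Suc j * x)"
        using pos m by (intro divide_right_mono) auto
      also have "\<dots> = r / real J" unfolding ratio using \<mu>01 assms by simp
      finally show "(\<Sum>n\<in>B j. 1 / real n) \<le> r / real J" .
    qed
    then show "(\<Sum>n\<in>S. 1 / real n) \<le> r" using assms by simp
    have "(\<Sum>j<J. \<mu> * r / real J - 1 / (\<mu> ^ J * x)) \<le> (\<Sum>n\<in>S. 1 / real n)"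
      unfolding sumS
    proof (rule sum_mono)
      fix j assume "j \<in> {..<J}"
      then have j: "j < J" by simp
      have pos: "0 < \<mu> ^ i * x" for i using \<mu>01 assms by simp
      have "\<mu> * r / real J - 1 / (\<mu> ^ J * x) \<le> \<mu> * r / real J - 1 / (\<mu> ^ j * x)"
        using j \<mu>01 assms pos by (intro diff_left_mono divide_left_mono mult_right_mono power_decreasing mult_pos_pos) auto
      also have "\<dots> = (c * (1 - \<mu>) * \<mu> ^ j * x - 1) / (\<mu> ^ j * x)"
        unfolding ratio using \<mu>01 assms by (simp add: diff_divide_distrib)
      also have "\<dots> \<le> real (m j) / (\<mu> ^ j * x)"
        using pos m by (intro divide_right_mono less_imp_le[OF pos]) auto
      also have "\<dots> = (\<Sum>n\<in>B j. 1 / (\<mu> ^ j * x))" using B(2)[OF j] by simp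
      also have "\<dots> \<le> (\<Sum>n\<in>B j. 1 / real n)"
      proof (intro sum_mono divide_left_mono)
        fix n assume n: "n \<in> B j"
        then have "real n > 0" using n_bounds(1)[OF j n] pos[of "Suc j"] by linarith
        then show "0 < \<mu> ^ j * x * real n" using pos[of j] by simp
        show "real n \<le> \<mu> ^ j * x" using n_bounds(2)[OF j n] .
      qed simp
      finally show "\<mu> * r / real J - 1 / (\<mu> ^ J * x) \<le> (\<Sum>n\<in>B j. 1 / real n)" .
    qed
    then show "\<mu> * r - real J / (\<mu> ^ J * x) \<le> (\<Sum>n\<in>S. 1 / real n)"
      using assms by (simp add: right_diff_distrib)
    have "c * (1 - \<mu> ^ J) * x - real J = (\<Sum>j<J. c * (1 - \<mu>) * \<mu> ^ j * x - 1)"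
      using \<mu>01 by (simp add: sum_subtractf sum_distrib_left[symmetric] sum_distrib_right[symmetric] sum_gp_strict)
    also have "\<dots> \<le> (\<Sum>j<J. real (m j))" by (intro sum_mono m)
    also have "\<dots> = (\<Sum>n\<in>S. 1)" unfolding sumS using B(2) by simp
    finally show "c * (1 - \<mu> ^ J) * x - real J \<le> real (card S)" by simp
  qed
qed

section \<open>Choice of scales and parameters, and assembly of the set\<close>

lemma eventually_dyadic_scale:
  fixes \<delta> \<kappa> \<epsilon> D :: real
  assumes "0 < \<delta>" "\<delta> < 1 / 2" "0 < \<kappa>" "0 < \<epsilon>"
  shows "\<forall>\<^sub>F x in at_top. \<exists>T. D \<le> 2 ^ T \<and> x powr (1 / 2 - \<delta>) < 2 ^ T \<and>
     D * 2 ^ T < \<kappa> * x \<and> x powr (1 / 2 - \<delta>) * 2 ^ T < \<kappa> * x \<and> x powr (1 / 2 - \<delta>) / 2 ^ T < \<epsilon>"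
proof -
  define a where "a = 1 / 2 - \<delta>"
  have a: "0 < a" "a < 1 / 2" using assms unfolding a_def by auto
  have "\<forall>\<^sub>F x::real in at_top. \<bar>D\<bar> \<le> sqrt x" by real_asymp
  moreover have "\<forall>\<^sub>F x::real in at_top. x powr a < sqrt x" using a by real_asymp
  moreover have "\<forall>\<^sub>F x::real in at_top. \<bar>D\<bar> * (2 * sqrt x) < \<kappa> * x" using assms by real_asymp
  moreover have "\<forall>\<^sub>F x::real in at_top. x powr a * (2 * sqrt x) < \<kappa> * x" using a assms by real_asymp
  moreover have "\<forall>\<^sub>F x::real in at_top. x powr a / sqrt x < \<epsilon>" using a assms by real_asymp
  moreover have "\<forall>\<^sub>F x::real in at_top. x > 1" by (rule eventually_gt_at_top)
  ultimately show ?thesis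
  proof eventually_elim
    case (elim x)
    \<comment> \<open>This puts \<open>2 ^ T\<close> between \<open>sqrt x\<close> and
      \<open>2 * sqrt x\<close>: above \<open>x powr a\<close>, yet with
      \<open>x powr a * 2 ^ T\<close> of order o(x), since \<open>a < 1 / 2\<close>.\<close>
    define T where "T = nat \<lceil>log 2 (sqrt x)\<rceil>"
    have "log 2 (sqrt x) \<ge> 0" using elim by simp
    then have T: "log 2 (sqrt x) \<le> real T" "real T \<le> log 2 (sqrt x) + 1"
      unfolding T_def by linarith+
    have "2 powr log 2 (sqrt x) \<le> 2 powr real T" using T by simp
    then have T1: "sqrt x \<le> 2 ^ T" using elim by (simp add: powr_realpow)
    have "2 powr real T \<le> 2 powr (log 2 (sqrt x) + 1)" using T by simp
    then have T2: "2 ^ T \<le> 2 * sqrt x" using elim by (simp add: powr_realpow powr_add)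
    have "D * 2 ^ T \<le> \<bar>D\<bar> * (2 * sqrt x)" using T2 by (intro mult_mono) auto
    moreover have "x powr a * 2 ^ T \<le> x powr a * (2 * sqrt x)" using T2 by (intro mult_left_mono) auto
    moreover have "x powr a / 2 ^ T \<le> x powr a / sqrt x"
      using T1 elim by (intro divide_left_mono mult_pos_pos) auto
    ultimately show ?case
      unfolding a_def[symmetric] using elim T1 by (intro exI[of _ T] conjI) linarith+
  qed
qed

theorem theorem1:
  fixes r :: rat and \<eta> :: real
  assumes "r > 0" and "\<eta> > 0"
  shows "\<exists>x0::real. \<forall>x\<ge>x0. \<exists>S::nat set.
           S \<subseteq> {n. 0 < n \<and> real n \<le> x} \<and>
           real_of_rat r = (\<Sum>n\<in>S. 1 / real n) \<and>
           real (card S) > (egyptian_density (real_of_rat r) - \<eta>) * x"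
proof -
  define R where "R = real_of_rat r"
  have R: "R > 0" using assms unfolding R_def by simp
  define c where "c = 1 - ln (2::real)"
  have c: "c > 0" unfolding c_def using ln_2_less_1 by simp
  have dens: "egyptian_density R = c * (1 - exp (- R / c))"
    unfolding egyptian_density_def c_def ..

  \<comment> \<open>A slack \<open>s\<close> is taken off both density and target. The first loss
    pays for \<open>\<delta>\<close> and \<open>K\<close>, the second leaves room for the prime
    corrections. By continuity at 0 the size constant drops by less than
    \<open>\<eta> / 2\<close>.\<close>
  have "((\<lambda>s. (c - s) * (1 - exp (- (R - s) / (c - s)))) \<longlongrightarrow> (c - 0) * (1 - exp (- (R - 0) / (c - 0)))) (at_right 0)"
    using c by (intro tendsto_intros) auto
  then have "\<forall>\<^sub>F s in at_right 0. (c - s) * (1 - exp (- (R - s) / (c - s))) > egyptian_density R - \<eta> / 2"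
    using assms by (intro order_tendstoD(1)) (auto simp: dens)
  moreover have "\<forall>\<^sub>F s in at_right 0. s \<in> {0<..<Min {c, R, 1 / 4}}"
    using c R by (intro eventually_at_rightI[of 0 "Min {c, R, 1 / 4}"]) auto
  ultimately have "\<forall>\<^sub>F s in at_right 0. (c - s) * (1 - exp (- (R - s) / (c - s))) > egyptian_density R - \<eta> / 2 \<and>
      s \<in> {0<..<Min {c, R, 1 / 4}}"
    by (rule eventually_conj)
  then obtain s where s: "(c - s) * (1 - exp (- (R - s) / (c - s))) > egyptian_density R - \<eta> / 2"
    "0 < s" "s < c" "s < R" "s < 1 / 4"
    by (auto dest!: eventually_happens'[OF trivial_limit_at_right_real])
  define c' where "c' = c - s"
  define r' where "r' = R - s"
  have c': "c' > 0" and r': "r' > 0" using s unfolding c'_def r'_def by auto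

  define \<mu> where "\<mu> = (\<lambda>J::nat. 1 / (1 + r' / c' / real J))"
  \<comment> \<open>The selected range reaches down to \<open>\<mu> J ^ J * x\<close>. Compound
    interest turns this fraction of \<open>x\<close> into \<open>exp (- r' / c')\<close> in the
    limit of many blocks.\<close>
  have "(\<lambda>J. inverse ((1 + r' / c' / real J) ^ J)) \<longlonglongrightarrow> inverse (exp (r' / c'))"
    by (intro tendsto_inverse tendsto_exp_limit_sequentially) auto
  then have "(\<lambda>J. \<mu> J ^ J) \<longlonglongrightarrow> exp (- r' / c')"
    by (simp add: \<mu>_def power_one_over exp_minus inverse_eq_divide)
  then have "(\<lambda>J. c' * (1 - \<mu> J ^ J)) \<longlonglongrightarrow> c' * (1 - exp (- r' / c'))"
    by (intro tendsto_intros)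
  then have "\<forall>\<^sub>F J in sequentially. c' * (1 - \<mu> J ^ J) > egyptian_density R - \<eta> / 2"
    using s(1) unfolding c'_def r'_def by (intro order_tendstoD(1))
  \<comment> \<open>The selected reciprocals must sum to more than \<open>R - 1\<close>. Half of
    this unit is allotted here, the other half to the rounding error
    \<open>J / (m ^ J * x)\<close>.\<close>
  moreover have "(\<lambda>J. \<mu> J * r') \<longlonglongrightarrow> r'"
    unfolding \<mu>_def using c' r' by real_asymp
  then have "\<forall>\<^sub>F J in sequentially. \<mu> J * r' > R - 1 / 2"
    using s by (intro order_tendstoD(1)) (auto simp: r'_def)
  ultimately have "\<forall>\<^sub>F J in sequentially. c' * (1 - \<mu> J ^ J) > egyptian_density R - \<eta> / 2 \<and>
     \<mu> J * r' > R - 1 / 2 \<and> J > 0"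
    using eventually_gt_at_top[of 0] by eventually_elim auto
  then obtain J where J: "c' * (1 - \<mu> J ^ J) > egyptian_density R - \<eta> / 2"
     "\<mu> J * r' > R - 1 / 2" "J > 0"
    using eventually_happens' sequentially_bot by blast
  define m where "m = \<mu> J"
  have m: "0 < m" "m < 1" unfolding m_def \<mu>_def using J c' r' by (auto simp: field_simps add_pos_pos)

  have "((\<lambda>\<delta>::real. 1 + ln (1 / 2 - \<delta>)) \<longlongrightarrow> 1 + ln (1 / 2 - 0)) (at_right 0)"
    by (intro tendsto_intros) auto
  \<comment> \<open>At \<open>\<delta> = 0\<close> the left side is
    \<open>1 - ln 2 = c' + s\<close>. Half of \<open>s\<close> is spent on \<open>\<delta>\<close>,
    the other half on \<open>1 / K\<close>.\<close>
  then have "\<forall>\<^sub>F \<delta> in at_right 0. 1 + ln (1 / 2 - \<delta>) > c' + s / 2"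
    using s by (intro order_tendstoD(1)) (auto simp: c'_def c_def ln_div)
  moreover have "\<forall>\<^sub>F \<delta>::real in at_right 0. \<delta> \<in> {0<..<1/2}"
    by (intro eventually_at_rightI[of 0 "1 / 2"]) auto
  ultimately have "\<forall>\<^sub>F \<delta> in at_right 0. 1 + ln (1 / 2 - \<delta>) > c' + s / 2 \<and> \<delta> \<in> {0<..<1/2}"
    by (rule eventually_conj)
  then obtain \<delta> where \<delta>: "1 + ln (1 / 2 - \<delta>) > c' + s / 2" "0 < \<delta>" "\<delta> < 1 / 2"
    by (auto dest!: eventually_happens'[OF trivial_limit_at_right_real])

  have "R \<in> \<rat>" unfolding R_def by simp
  then obtain u v :: nat where v: "v \<noteq> 0" "\<bar>R\<bar> = real u / real v"
    by (rule Rats_abs_nat_div_natE)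
  then have Rv: "R * real v = real u" using R by simp
  \<comment> \<open>The three summands make primes above \<open>K ^ 3\<close> coprime to
    \<open>v\<close>, make them odd, and give \<open>1 / K < s / 2\<close>.\<close>
  define K where "K = v + 2 + nat \<lceil>2 / s\<rceil>"
  have K: "K > 0" "K \<ge> 2" "K \<ge> v" unfolding K_def by auto
  have "2 / s < real K" unfolding K_def using s by linarith
  then have "1 / real K < s / 2" using s K by (simp add: field_simps)
  then have cK: "c' < 1 + ln (1 / 2 - \<delta>) - 1 / real K" using \<delta> by linarith
  have "K ^ 1 \<le> K ^ 3" using K by (intro power_increasing) auto
  then have K3: "K \<le> K ^ 3" by simp
  \<comment> \<open>\<open>v\<close> clears the denominator of \<open>R\<close>, and the factorial
    absorbs the small prime powers of the selected integers. \<open>D\<close> does not depend on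
    \<open>x\<close>.\<close>
  define D where "D = v * fact (K ^ 3)"
  have D: "D > 0" unfolding D_def using v by simp

  \<comment> \<open>The shortest block has length \<open>m ^ (J - 1) * (1 - m) * x\<close>, so this
    one threshold serves all \<open>J\<close> blocks.\<close>
  have ev_density: "\<forall>\<^sub>F x in at_top. \<forall>z w. 0 \<le> z \<longrightarrow> w \<le> x \<longrightarrow> m ^ J * (1 - m) * x \<le> w - z \<longrightarrow>
     c' * (w - z) \<le> real (card (nats_between z w \<inter> smooth_nats (nat \<lfloor>x powr (1 / 2 - \<delta>)\<rfloor>) K))"
    using m by (intro smooth_density \<delta> K cK) auto
  have ev_scale: "\<forall>\<^sub>F x in at_top. \<exists>T. real D \<le> 2 ^ T \<and> x powr (1 / 2 - \<delta>) < 2 ^ T \<and>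
     real D * 2 ^ T < m ^ J * x \<and> x powr (1 / 2 - \<delta>) * 2 ^ T < m ^ J * x \<and> x powr (1 / 2 - \<delta>) / 2 ^ T < s"
    using m s by (intro eventually_dyadic_scale \<delta>) auto
  have "\<forall>\<^sub>F x in at_top. real J / (q * x) < 1 / 2" if "q > 0" for q :: real
    using that by real_asymp
  then have ev_J: "\<forall>\<^sub>F x in at_top. real J / (m ^ J * x) < 1 / 2"
    using m by simp
  have ev_\<eta>: "\<forall>\<^sub>F x in at_top. real J < \<eta> / 2 * x"
    using assms(2) by real_asymp
  have "\<forall>\<^sub>F x in at_top. \<exists>S::nat set. S \<subseteq> {n. 0 < n \<and> real n \<le> x} \<and>
           R = (\<Sum>n\<in>S. 1 / real n) \<and> real (card S) > (egyptian_density R - \<eta>) * x"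
    using ev_density ev_scale ev_J ev_\<eta> eventually_gt_at_top[of 0]
  proof eventually_elim
    case (elim x)
    define P where "P = nat \<lfloor>x powr (1 / 2 - \<delta>)\<rfloor>"
    have P: "real P \<le> x powr (1 / 2 - \<delta>)" unfolding P_def by simp
    obtain T where T: "real D \<le> 2 ^ T" "x powr (1 / 2 - \<delta>) < 2 ^ T" "real D * 2 ^ T < m ^ J * x"
      "x powr (1 / 2 - \<delta>) * 2 ^ T < m ^ J * x" "x powr (1 / 2 - \<delta>) / 2 ^ T < s"
      using elim(2) by blast
    have PT: "real P * 2 ^ T < m ^ J * x"
      by (rule le_less_trans[OF mult_right_mono[OF P] T(4)]) simp
    have dense: "c' * (m ^ j * x - m ^ Suc j * x) \<le>
        real (card (nats_between (m ^ Suc j * x) (m ^ j * x) \<inter> smooth_nats P K))" if "j < J" for j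
    proof -
      have "m ^ j * x \<le> 1 * x"
        using m elim by (intro mult_right_mono power_le_one) auto
      moreover have "m ^ J * (1 - m) * x \<le> m ^ j * (1 - m) * x"
        using m elim that by (intro mult_right_mono power_decreasing) auto
      then have "m ^ J * (1 - m) * x \<le> m ^ j * x - m ^ Suc j * x"
        by (simp add: algebra_simps)
      moreover have "0 \<le> m ^ Suc j * x" using m elim by simp
      ultimately show ?thesis using elim(1) unfolding P_def by simp
    qed
    obtain S\<^sub>0 where S\<^sub>0: "S\<^sub>0 \<subseteq> nats_between (m ^ J * x) x \<inter> smooth_nats P K"
      "(\<Sum>n\<in>S\<^sub>0. 1 / real n) \<le> r'" "m * r' - real J / (m ^ J * x) \<le> (\<Sum>n\<in>S\<^sub>0. 1 / real n)"
      "c' * (1 - m ^ J) * x - real J \<le> real (card S\<^sub>0)"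
      using select_with_constant_density[OF c' r' elim(5) J(3) m_def[unfolded \<mu>_def] dense] by metis
    have fin: "finite S\<^sub>0" using S\<^sub>0(1) by (meson finite_Int finite_nats_between finite_subset)
    define Q where "Q = {p. prime p \<and> p \<in> {K ^ 3<..P}}"
    have "finite Q" unfolding Q_def by simp
    have cardQ: "card Q \<le> P"
    proof -
      have "Q \<subseteq> {0<..P}" unfolding Q_def by (auto simp: prime_gt_0_nat)
      then show ?thesis using card_mono[of "{0<..P}" Q] by simp
    qed
    obtain S where S: "S\<^sub>0 \<subseteq> S" "finite S" "R = (\<Sum>n\<in>S. 1 / real n)"
      "\<And>n. n \<in> S - S\<^sub>0 \<Longrightarrow> 0 < n \<and> n \<le> max (D * 2 ^ T) (P * 2 ^ T)"
    proof (rule complete_to_egyptian_fraction[OF D _ \<open>finite Q\<close> _ _ fin])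
      have "real D \<le> real (2 ^ T)" using T(1) by simp
      then show "D \<le> 2 ^ T" by (simp only: of_nat_le_iff)
      show "prime p \<and> odd p \<and> coprime D p \<and> p \<le> P \<and> p < 2 ^ T" if "p \<in> Q" for p
      proof -
        have p: "prime p" "K ^ 3 < p" "p \<le> P" using that unfolding Q_def by auto
        have "odd p" using p K K3 prime_odd_nat[of p] by simp
        have "\<not> p dvd v" using p K K3 v(1) by (auto dest: dvd_imp_le)
        moreover have "\<not> p dvd fact (K ^ 3)" using p by (simp add: prime_dvd_fact_iff)
        ultimately have "\<not> p dvd D" unfolding D_def using p by (simp add: prime_dvd_mult_iff)
        then have "coprime D p" using p by (metis coprime_commute prime_imp_coprime)
        have "real p \<le> real P" using p by simp
        also note P
        also note T(2)
        finally have "p < 2 ^ T" by simp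
        then show ?thesis using p \<open>odd p\<close> \<open>coprime D p\<close> by simp
      qed
      have "R * real D = real u * fact (K ^ 3)" unfolding D_def using Rv by (simp add: mult.assoc[symmetric])
      also have "\<dots> = of_nat (u * fact (K ^ 3))" by simp
      finally show "R * real D \<in> \<int>" by (metis Ints_of_nat)
      show "n > D * 2 ^ T \<and> n > P * 2 ^ T \<and> n dvd D * \<Prod>Q" if "n \<in> S\<^sub>0" for n
      proof -
        have "m ^ J * x < real n" and n: "n \<in> smooth_nats P K"
          using that S\<^sub>0(1) unfolding nats_between_def by auto
        then have "real (D * 2 ^ T) < real n" "real (P * 2 ^ T) < real n" using T PT by auto
        moreover have "n dvd fact (K ^ 3) * \<Prod>Q"
          using n unfolding Q_def smooth_nats_def by (intro smooth_dvd_fact_times_primes) auto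
        then have "n dvd D * \<Prod>Q" unfolding D_def by (simp add: mult.assoc)
        ultimately show ?thesis by (simp only: of_nat_less_iff)
      qed
      \<comment> \<open>The corrections cost at most \<open>card Q / 2 ^ T < s\<close>, which is
        exactly the gap left between \<open>r'\<close> and \<open>R\<close>.\<close>
      have "real (card Q) / 2 ^ T \<le> x powr (1 / 2 - \<delta>) / 2 ^ T"
        using cardQ P by (intro divide_right_mono) auto
      then show "(\<Sum>n\<in>S\<^sub>0. 1 / real n) \<le> R - real (card Q) / 2 ^ T"
        using S\<^sub>0(2) T(5) unfolding r'_def by linarith
      show "R - 1 < (\<Sum>n\<in>S\<^sub>0. 1 / real n)"
        using S\<^sub>0(3) J(2) elim(3) unfolding m_def by linarith
    qed (use that in blast)
    \<comment> \<open>One half of \<open>\<eta>\<close> covers the passage to the limiting constant,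
      the other half the \<open>J\<close> elements lost to rounding.\<close>
    have "(egyptian_density R - \<eta>) * x = (egyptian_density R - \<eta> / 2) * x - \<eta> / 2 * x"
      by (simp add: algebra_simps)
    also have "\<dots> < c' * (1 - m ^ J) * x - real J"
      using J(1) elim(4,5) unfolding m_def by (intro diff_strict_mono mult_strict_right_mono) auto
    also have "\<dots> \<le> real (card S\<^sub>0)" by (rule S\<^sub>0(4))
    also have "\<dots> \<le> real (card S)" using S(1,2) by (simp add: card_mono)
    finally have card: "(egyptian_density R - \<eta>) * x < real (card S)" .
    have "0 < n \<and> real n \<le> x" if "n \<in> S" for n
    proof (cases "n \<in> S\<^sub>0")
      case True
      then show ?thesis using S\<^sub>0(1) unfolding nats_between_def smooth_nats_def by auto
    next
      case False
      then have n: "0 < n" "n \<le> D * 2 ^ T \<or> n \<le> P * 2 ^ T"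
        using S(4)[of n] that by (auto simp: le_max_iff_disj)
      then have "real n \<le> real (D * 2 ^ T) \<or> real n \<le> real (P * 2 ^ T)"
        by (simp only: of_nat_le_iff)
      then have "real n \<le> m ^ J * x" using T(3) PT by auto
      also have "\<dots> \<le> 1 * x" using m elim by (intro mult_right_mono power_le_one) auto
      finally show ?thesis using n by simp
    qed
    then show ?case using S(3) card by blast
  qed
  then show ?thesis
    unfolding eventually_at_top_linorder R_def .
qed

end
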